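(* There is a learning algorithm without quantum memory that uses $T=\mathcal{O}(2^{n/2})$ copies of an unknown $n$-qubit state $\rho$ and distinguishes, with success probability at least $2/3$, between the case that $\rho$ is a pure state and the case that $\rho=I/2^n$ is maximally mixed.
   Context: An $n$-qubit state is a $2^n\times 2^n$ positive semidefinite complex matrix of trace one; it is pure if it has rank one. A learning algorithm without quantum memory using $T$ copies of an unknown $n$-qubit state $\rho$ proceeds in $T$ rounds: in each round it receives a fresh copy of $\rho$, chooses a POVM $\{F_s\}_s$ on $n$ qubits (positive semidefinite matrices with $\sum_s F_s=I$), where the choice may depend arbitrarily on all previously observed classical outcomes (and on internal classical randomness), and observes outcome $s$ with probability $\mathrm{Tr}(F_s\rho)$; no quantum state is retained between rounds. Its final output is an arbitrary function of the observed classical outcomes. *)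

theory Defs
  imports "Jordan_Normal_Form.Schur_Decomposition" "Jordan_Normal_Form.DL_Rank"
          "HOL-Probability.Probability_Mass_Function"
begin

definition mat_trace :: "complex mat \<Rightarrow> complex" where
  "mat_trace A = (\<Sum>i<dim_row A. A $$ (i, i))"

definition psd :: "nat \<Rightarrow> complex mat \<Rightarrow> bool" where
  "psd d A \<longleftrightarrow> A \<in> carrier_mat d d \<and> mat_adjoint A = A \<and>
     (\<forall>v \<in> carrier_vec d. (mult_mat_vec A v) \<bullet>c v \<in> \<real> \<and> Re ((mult_mat_vec A v) \<bullet>c v) \<ge> 0)"

definition qstate :: "nat \<Rightarrow> complex mat \<Rightarrow> bool" where
  "qstate n \<rho> \<longleftrightarrow> psd (2^n) \<rho> \<and> mat_trace \<rho> = 1"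

definition pure_state :: "nat \<Rightarrow> complex mat \<Rightarrow> bool" where
  "pure_state n \<rho> \<longleftrightarrow> qstate n \<rho> \<and> vec_space.rank (2^n) \<rho> = 1"

definition max_mixed :: "nat \<Rightarrow> complex mat" where
  "max_mixed n = (1 / of_nat (2^n)) \<cdot>\<^sub>m 1\<^sub>m (2^n)"

definition povm_support :: "nat \<Rightarrow> (nat \<Rightarrow> complex mat) \<Rightarrow> nat set" where
  "povm_support d F = {s. F s \<noteq> 0\<^sub>m d d}"

definition is_povm :: "nat \<Rightarrow> (nat \<Rightarrow> complex mat) \<Rightarrow> bool" where
  "is_povm n F \<longleftrightarrow> finite (povm_support (2^n) F) \<and> (\<forall>s. psd (2^n) (F s)) \<and>
     (\<forall>i < 2^n. \<forall>j < 2^n.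
        (\<Sum>s \<in> povm_support (2^n) F. F s $$ (i, j)) = 1\<^sub>m (2^n) $$ (i, j))"

text \<open>Probability that an adaptive single-copy strategy M (POVM chosen from the history of
  previous outcomes) with output rule f outputs True, when k further copies of rho are
  measured starting from history h.\<close>
fun accept_from :: "nat \<Rightarrow> complex mat \<Rightarrow> (nat list \<Rightarrow> nat \<Rightarrow> complex mat) \<Rightarrow>
    (nat list \<Rightarrow> bool) \<Rightarrow> nat \<Rightarrow> nat list \<Rightarrow> real" where
  "accept_from n \<rho> M f 0 h = (if f h then 1 else 0)"
| "accept_from n \<rho> M f (Suc k) h =
     (\<Sum>s \<in> povm_support (2^n) (M h). Re (mat_trace (M h s * \<rho>)) * accept_from n \<rho> M f k (h @ [s]))"

text \<open>Algorithm without quantum memory using T copies: internal classical randomness r drawn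
  from R, then adaptive POVMs M r, final output f r of the outcome transcript.\<close>
definition accept_prob :: "nat \<Rightarrow> nat pmf \<Rightarrow> (nat \<Rightarrow> nat list \<Rightarrow> nat \<Rightarrow> complex mat) \<Rightarrow>
    (nat \<Rightarrow> nat list \<Rightarrow> bool) \<Rightarrow> nat \<Rightarrow> complex mat \<Rightarrow> real" where
  "accept_prob n R M f T \<rho> = measure_pmf.expectation R (\<lambda>r. accept_from n \<rho> (M r) (f r) T [])"

end

theory Submission
  imports Defs "Jordan_Normal_Form.DL_Rank_Submatrix"
begin

text \<open>
  One fixed, non-adaptive POVM suffices, and no randomness is needed. With \<open>d = 2 ^ n\<close>, measure all
  qubits but the last in the computational basis, and the last one in the eigenbasis of a uniformly
  chosen Pauli matrix; this has \<open>3 * d\<close> outcomes. On \<open>I / d\<close> the outcome is uniform, so two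
  independent outcomes collide with probability \<open>1 / (3 * d)\<close>. If the state is pure, then the last
  qubit, given the outcome \<open>i\<close> on the others, is again in a pure state. The six Pauli eigenvectors
  form a 2-design, so the outcomes belonging to \<open>i\<close> contribute exactly \<open>2 / 9 * u\<^sub>i\<^sup>2\<close> to the collision
  probability, where \<open>u\<^sub>i\<close> is the probability of \<open>i\<close>. As there are \<open>d / 2\<close> values of \<open>i\<close>, the
  collision probability is at least \<open>4 / (9 * d)\<close>, larger by the factor \<open>4 / 3\<close>.

  For \<open>T\<close> independent samples with collision probability \<open>p\<close>, the number of colliding pairs has mean
  \<open>T * (T - 1) / 2 * p\<close> and relative variance \<open>O(1 / (T * sqrt p))\<close>, so by Chebyshev's inequality
  \<open>T = O(sqrt d)\<close> samples separate the two cases.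
\<close>

section \<open>Collision statistics of independent samples\<close>

text \<open>Expectation over k independent samples as a nested finite sum. Peeling off the first
  sample yields recurrences in k for all moments and mirrors the recursion of
  \<open>accept_from\<close>.\<close>

fun iid_expectation :: "'a set \<Rightarrow> ('a \<Rightarrow> real) \<Rightarrow> nat \<Rightarrow> ('a list \<Rightarrow> real) \<Rightarrow> real" where
  "iid_expectation A q 0 g = g []"
| "iid_expectation A q (Suc k) g = (\<Sum>s\<in>A. q s * iid_expectation A q k (\<lambda>l. g (s # l)))"

text \<open>The number of unordered pairs of positions carrying equal entries, arranged so that
  prepending a sample adds a single count.\<close>

fun collisions :: "'a list \<Rightarrow> nat" where
  "collisions [] = 0"
| "collisions (x # xs) = count_list xs x + collisions xs"

lemma iid_expectation_add:
  "iid_expectation A q k (\<lambda>l. g l + h l) = iid_expectation A q k g + iid_expectation A q k h"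
  by (induction k arbitrary: g h) (simp_all add: distrib_left sum.distrib)

lemma iid_expectation_cmult:
  "iid_expectation A q k (\<lambda>l. c * g l) = c * iid_expectation A q k g"
  by (induction k arbitrary: g) (simp_all add: sum_distrib_left mult.left_commute)

lemma iid_expectation_sum:
  "finite B \<Longrightarrow> iid_expectation A q k (\<lambda>l. \<Sum>b\<in>B. g b l) = (\<Sum>b\<in>B. iid_expectation A q k (g b))"
proof (induction B rule: finite_induct)
  case empty
  show ?case using iid_expectation_cmult[of A q k 0 "\<lambda>_. 0"] by simp
qed (simp add: iid_expectation_add)

lemma iid_expectation_mono:
  assumes "\<And>s. s \<in> A \<Longrightarrow> q s \<ge> 0" and "\<And>l. g l \<le> h l"
  shows "iid_expectation A q k g \<le> iid_expectation A q k h"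
  using assms(2)
proof (induction k arbitrary: g h)
  case (Suc k)
  show ?case
    unfolding iid_expectation.simps
    by (intro sum_mono mult_left_mono assms(1) Suc.IH Suc.prems)
qed simp

section \<open>Moments of the collision count\<close>

locale finite_distribution =
  fixes A :: "'a set" and q :: "'a \<Rightarrow> real"
  assumes fin: "finite A" and nonneg: "s \<in> A \<Longrightarrow> q s \<ge> 0" and total: "sum q A = 1"
begin

abbreviation "\<E> \<equiv> iid_expectation A q"

text \<open>\<open>power_sum 2\<close> is the probability that two samples collide,
  \<open>power_sum 3\<close> that three samples coincide; together they determine the mean and
  variance of \<open>collisions\<close>.\<close>

definition "power_sum j = (\<Sum>s\<in>A. q s ^ j)"

lemma expectation_const [simp]: "\<E> k (\<lambda>_. c) = c"
  by (induction k) (simp_all add: sum_distrib_right[symmetric] total)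

lemma sum_q_point: "s \<in> A \<Longrightarrow> (\<Sum>t\<in>A. q t * of_bool (t = s)) = q s"
  using fin by (simp add: of_bool_def if_distrib cong: if_cong)

text \<open>The count is binomial with parameters k and \<open>q s\<close>. This lemma and the next
  obtain its first two moments by conditioning on the first sample.\<close>

lemma expectation_count: "s \<in> A \<Longrightarrow> \<E> k (\<lambda>l. real (count_list l s)) = real k * q s"
proof (induction k)
  case (Suc k)
  have "\<E> (Suc k) (\<lambda>l. real (count_list l s))
      = (\<Sum>t\<in>A. q t * \<E> k (\<lambda>l. of_bool (t = s) + real (count_list l s)))"
    by (auto intro!: sum.cong arg_cong[where f="\<E> k"])
  also have "\<dots> = (\<Sum>t\<in>A. q t * of_bool (t = s) + q t * (real k * q s))"
    using Suc by (simp add: iid_expectation_add distrib_left)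
  also have "\<dots> = q s + real k * q s"
    unfolding sum.distrib sum_distrib_right[symmetric]
    using Suc.prems by (simp add: total sum_q_point)
  finally show ?case by (simp add: distrib_right)
qed simp

lemma expectation_count_sq:
  "s \<in> A \<Longrightarrow> \<E> k (\<lambda>l. (real (count_list l s))\<^sup>2) = real k * q s + real k * (real k - 1) * (q s)\<^sup>2"
proof (induction k)
  case (Suc k)
  have "\<E> (Suc k) (\<lambda>l. (real (count_list l s))\<^sup>2)
      = (\<Sum>t\<in>A. q t * \<E> k (\<lambda>l. of_bool (t = s) + of_bool (t = s) * 2 * real (count_list l s)
            + (real (count_list l s))\<^sup>2))"
    by (auto intro!: sum.cong arg_cong[where f="\<E> k"] simp: power2_eq_square algebra_simps)
  also have "\<dots> = (\<Sum>t\<in>A. q t * of_bool (t = s) * (1 + 2 * (real k * q s))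
        + q t * (real k * q s + real k * (real k - 1) * (q s)\<^sup>2))"
    using Suc
    by (intro sum.cong refl)
      (simp add: iid_expectation_add iid_expectation_cmult expectation_count distrib_left)
  also have "\<dots> = q s * (1 + 2 * (real k * q s)) + (real k * q s + real k * (real k - 1) * (q s)\<^sup>2)"
    unfolding sum.distrib sum_distrib_right[symmetric]
    using Suc.prems by (simp add: total sum_q_point)
  finally show ?case by (simp add: algebra_simps power2_eq_square)
qed simp

lemma expectation_collisions:
  "\<E> k (\<lambda>l. real (collisions l)) = real k * (real k - 1) / 2 * power_sum 2"
proof (induction k)
  case (Suc k)
  have "\<E> (Suc k) (\<lambda>l. real (collisions l))
      = (\<Sum>s\<in>A. real k * (q s)\<^sup>2 + q s * (real k * (real k - 1) / 2 * power_sum 2))"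
    by (auto intro!: sum.cong
        simp: iid_expectation_add expectation_count Suc power2_eq_square algebra_simps)
  also have "\<dots> = real k * power_sum 2 + real k * (real k - 1) / 2 * power_sum 2"
    unfolding sum.distrib sum_distrib_left[symmetric] sum_distrib_right[symmetric]
    by (simp add: total power_sum_def)
  finally show ?case by (simp add: field_simps)
qed simp

text \<open>For l over \<open>A\<close>, this is the expected number of entries of l equal to a
  fresh sample (\<open>weighted_count\<close>). It appears when the head is averaged out in the
  recurrence for the second moment of \<open>collisions\<close>.\<close>

definition weight :: "'a list \<Rightarrow> real" where
  "weight l = (\<Sum>s\<leftarrow>l. q s)"

lemma weight_simps [simp]: "weight [] = 0" "weight (s # l) = q s + weight l"
  by (simp_all add: weight_def)

lemma sum_q_powers:
  "(\<Sum>s\<in>A. q s * q s) = power_sum 2" "(\<Sum>s\<in>A. q s * (q s * q s)) = power_sum 3"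
  by (simp_all add: power_sum_def power2_eq_square power3_eq_cube mult.assoc)

lemma expectation_weight: "\<E> k weight = real k * power_sum 2"
proof (induction k)
  case (Suc k)
  have "\<E> (Suc k) weight = (\<Sum>s\<in>A. q s * q s + q s * (real k * power_sum 2))"
    by (simp add: iid_expectation_add Suc distrib_left)
  also have "\<dots> = power_sum 2 + real k * power_sum 2"
    by (simp add: sum.distrib sum_distrib_right[symmetric] total sum_q_powers)
  finally show ?case by (simp add: distrib_right)
qed simp

lemma expectation_weight_sq:
  "\<E> k (\<lambda>l. (weight l)\<^sup>2) = real k * power_sum 3 + real k * (real k - 1) * (power_sum 2)\<^sup>2"
proof (induction k)
  case (Suc k)
  have "\<E> (Suc k) (\<lambda>l. (weight l)\<^sup>2)
      = (\<Sum>s\<in>A. q s * \<E> k (\<lambda>l. q s * q s + 2 * q s * weight l + (weight l)\<^sup>2))"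
    by (simp add: power2_eq_square algebra_simps)
  also have "\<dots> = (\<Sum>s\<in>A. q s * (q s * q s) + q s * q s * (2 * real k * power_sum 2)
      + q s * (real k * power_sum 3 + real k * (real k - 1) * (power_sum 2)\<^sup>2))"
    by (simp add: iid_expectation_add iid_expectation_cmult expectation_weight Suc algebra_simps)
  also have "\<dots> = power_sum 3 + power_sum 2 * (2 * real k * power_sum 2)
      + (real k * power_sum 3 + real k * (real k - 1) * (power_sum 2)\<^sup>2)"
    by (simp add: sum.distrib sum_distrib_right[symmetric] total sum_q_powers)
  finally show ?case by (simp add: algebra_simps power2_eq_square)
qed simp

lemma weighted_count: "set l \<subseteq> A \<Longrightarrow> (\<Sum>s\<in>A. q s * real (count_list l s)) = weight l"
proof (induction l)
  case (Cons a l)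
  have "(\<Sum>s\<in>A. q s * real (count_list (a # l) s))
      = (\<Sum>s\<in>A. q s * of_bool (s = a) + q s * real (count_list l s))"
    by (intro sum.cong) (auto simp: algebra_simps)
  then show ?case
    using Cons by (simp add: sum.distrib sum_q_point)
qed simp

text \<open>The nested sums only ever visit lists over \<open>A\<close>, so agreement on those
  suffices.\<close>

lemma expectation_cong:
  assumes "\<And>l. set l \<subseteq> A \<Longrightarrow> g l = h l"
  shows "\<E> k g = \<E> k h"
  using assms
proof (induction k arbitrary: g h)
  case (Suc k)
  have "\<E> k (\<lambda>l. g (s # l)) = \<E> k (\<lambda>l. h (s # l))" if "s \<in> A" for s
    by (rule Suc.IH) (rule Suc.prems, use that in simp)
  then show ?case by simp
qed simp

text \<open>Exchanging the average over a fresh sample s with the average over l turns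
  \<open>count_list l s\<close> into \<open>weight l\<close>.\<close>

lemma expectation_weighted_count:
  "(\<Sum>s\<in>A. q s * \<E> k (\<lambda>l. real (count_list l s) * g l)) = \<E> k (\<lambda>l. weight l * g l)"
proof -
  have "(\<Sum>s\<in>A. q s * \<E> k (\<lambda>l. real (count_list l s) * g l))
      = \<E> k (\<lambda>l. \<Sum>s\<in>A. q s * (real (count_list l s) * g l))"
    by (simp add: iid_expectation_sum fin iid_expectation_cmult)
  also have "\<dots> = \<E> k (\<lambda>l. weight l * g l)"
    by (intro expectation_cong)
      (simp add: weighted_count[symmetric] sum_distrib_right mult.assoc)
  finally show ?thesis .
qed

text \<open>Choose a position and a pair of positions. In k(k-1) choices the position lies in the
  pair, each contributing \<open>power_sum 3\<close>; in the other k(k-1)(k-2)/2 it does not, and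
  independence gives the square of \<open>power_sum 2\<close>.\<close>

lemma expectation_weight_collisions:
  "\<E> k (\<lambda>l. weight l * real (collisions l))
     = real k * (real k - 1) * power_sum 3
       + real k * (real k - 1) * (real k - 2) / 2 * (power_sum 2)\<^sup>2"
proof (induction k)
  case (Suc k)
  let ?N = "real k * (real k - 1) / 2 * power_sum 2"
  let ?X = "real k * (real k - 1) * power_sum 3
       + real k * (real k - 1) * (real k - 2) / 2 * (power_sum 2)\<^sup>2"
  have "\<E> (Suc k) (\<lambda>l. weight l * real (collisions l))
      = (\<Sum>s\<in>A. q s * \<E> k (\<lambda>l. q s * real (count_list l s) + q s * real (collisions l)
          + real (count_list l s) * weight l + weight l * real (collisions l)))"
    by (simp add: algebra_simps)
  also have "\<dots> = (\<Sum>s\<in>A. q s * (q s * q s) * real k + q s * q s * ?N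
       + q s * \<E> k (\<lambda>l. real (count_list l s) * weight l) + q s * ?X)"
    by (intro sum.cong refl)
      (simp add: iid_expectation_add iid_expectation_cmult expectation_count
        expectation_collisions Suc distrib_left)
  also have "\<dots> = power_sum 3 * real k + power_sum 2 * ?N + \<E> k (\<lambda>l. (weight l)\<^sup>2) + ?X"
    unfolding sum.distrib sum_distrib_right[symmetric] expectation_weighted_count
    by (simp add: total sum_q_powers power2_eq_square)
  finally show ?case
    unfolding expectation_weight_sq by (simp add: field_simps power2_eq_square)
qed simp

text \<open>The three terms sort the ordered pairs of position pairs: those sharing exactly one
  position, disjoint ones, and identical ones. The induction reaches this count through the mixed
  moment with \<open>weight\<close>.\<close>

lemma expectation_collisions_sq:
  "\<E> k (\<lambda>l. (real (collisions l))\<^sup>2)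
     = real k * (real k - 1) * (real k - 2) * power_sum 3
       + real k * (real k - 1) * (real k - 2) * (real k - 3) / 4 * (power_sum 2)\<^sup>2
       + real k * (real k - 1) / 2 * power_sum 2"
proof (induction k)
  case (Suc k)
  let ?X = "real k * (real k - 1) * (real k - 2) * power_sum 3
       + real k * (real k - 1) * (real k - 2) * (real k - 3) / 4 * (power_sum 2)\<^sup>2
       + real k * (real k - 1) / 2 * power_sum 2"
  have "\<E> (Suc k) (\<lambda>l. (real (collisions l))\<^sup>2)
      = (\<Sum>s\<in>A. q s * \<E> k (\<lambda>l. (real (count_list l s))\<^sup>2
          + real (count_list l s) * (2 * real (collisions l)) + (real (collisions l))\<^sup>2))"
    by (simp add: algebra_simps power2_eq_square)
  also have "\<dots> = (\<Sum>s\<in>A. q s * q s * real k + q s * (q s * q s) * (real k * (real k - 1))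
       + q s * \<E> k (\<lambda>l. real (count_list l s) * (2 * real (collisions l))) + q s * ?X)"
    by (intro sum.cong refl)
      (simp add: iid_expectation_add expectation_count_sq Suc distrib_left,
        simp add: power2_eq_square)
  also have "\<dots> = power_sum 2 * real k + power_sum 3 * (real k * (real k - 1))
       + 2 * \<E> k (\<lambda>l. weight l * real (collisions l)) + ?X"
    unfolding sum.distrib sum_distrib_right[symmetric] expectation_weighted_count
    using iid_expectation_cmult[of A q k 2 "\<lambda>l. weight l * real (collisions l)"]
    by (simp add: total sum_q_powers mult.left_commute)
  finally show ?case
    unfolding expectation_weight_collisions by (simp add: field_simps power2_eq_square)
qed simp

text \<open>Second moment minus squared mean: the terms of order k^4 cancel, leaving order
  k^3.\<close>

lemma variance_collisions:
  "\<E> k (\<lambda>l. (real (collisions l) - real k * (real k - 1) / 2 * power_sum 2)\<^sup>2)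
     = real k * (real k - 1) / 2 * power_sum 2
       + real k * (real k - 1) * (real k - 2) * power_sum 3
       - real k * (real k - 1) * (2 * real k - 3) / 2 * (power_sum 2)\<^sup>2"
proof -
  define \<mu> where "\<mu> = real k * (real k - 1) / 2 * power_sum 2"
  have "\<E> k (\<lambda>l. (real (collisions l) - \<mu>)\<^sup>2)
      = \<E> k (\<lambda>l. (real (collisions l))\<^sup>2 + (- 2 * \<mu>) * real (collisions l) + \<mu>\<^sup>2)"
    by (simp add: power2_eq_square algebra_simps)
  also have "\<dots> = \<E> k (\<lambda>l. (real (collisions l))\<^sup>2) - 2 * \<mu> * \<mu> + \<mu>\<^sup>2"
    unfolding iid_expectation_add iid_expectation_cmult expectation_collisions
    by (simp add: \<mu>_def)
  also have "\<dots> = \<E> k (\<lambda>l. (real (collisions l))\<^sup>2) - \<mu>\<^sup>2"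
    by (simp add: power2_eq_square)
  finally show ?thesis
    unfolding expectation_collisions_sq \<mu>_def by (simp add: field_simps power2_eq_square)
qed

section \<open>Tail bounds for the collision count\<close>

lemma chebyshev:
  assumes "\<delta> > 0" and "\<And>l. P l \<Longrightarrow> \<bar>g l - \<mu>\<bar> \<ge> \<delta>"
  shows "\<E> k (\<lambda>l. of_bool (P l)) \<le> \<E> k (\<lambda>l. (g l - \<mu>)\<^sup>2) / \<delta>\<^sup>2"
proof -
  \<comment> \<open>Markov's inequality for the squared deviation in pointwise form: the indicator
    never exceeds the squared deviation divided by the square of \<delta>.\<close>
  have "of_bool (P l) \<le> (1 / \<delta>\<^sup>2) * (g l - \<mu>)\<^sup>2" for l
  proof (cases "P l")
    case True
    then have "\<delta>\<^sup>2 \<le> (g l - \<mu>)\<^sup>2"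
      using assms abs_le_square_iff[of \<delta> "g l - \<mu>"] by fastforce
    then show ?thesis using True assms(1) by simp
  qed simp
  then have "\<E> k (\<lambda>l. of_bool (P l)) \<le> \<E> k (\<lambda>l. (1 / \<delta>\<^sup>2) * (g l - \<mu>)\<^sup>2)"
    by (intro iid_expectation_mono nonneg)
  then show ?thesis unfolding iid_expectation_cmult by simp
qed

text \<open>No single probability exceeds the Euclidean norm of q, so one factor of each cube can be
  replaced by that norm.\<close>

lemma power_sum_3_le: "power_sum 3 \<le> power_sum 2 * sqrt (power_sum 2)"
proof -
  have "q s ^ 3 \<le> (q s)\<^sup>2 * sqrt (power_sum 2)" if "s \<in> A" for s
  proof -
    have "(q s)\<^sup>2 \<le> power_sum 2"
      unfolding power_sum_def using fin that by (intro member_le_sum) auto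
    then have "q s \<le> sqrt (power_sum 2)" by (rule real_le_rsqrt)
    then have "(q s)\<^sup>2 * q s \<le> (q s)\<^sup>2 * sqrt (power_sum 2)" by (intro mult_left_mono) auto
    then show ?thesis by (simp add: power2_eq_square power3_eq_cube)
  qed
  then have "power_sum 3 \<le> (\<Sum>s\<in>A. (q s)\<^sup>2 * sqrt (power_sum 2))"
    unfolding power_sum_def[of 3] by (rule sum_mono)
  then show ?thesis by (simp add: power_sum_def[of 2] sum_distrib_right)
qed

text \<open>Let \<mu> be the mean and y = \<open>k * sqrt (power_sum 2)\<close>. Then \<mu> is at
  least y^2/4 and the variance at most \<mu> + 2\<mu>y. Falling to \<tau> requires a deviation of
  \<mu>/8, which has probability at most 64(1 + 2y)/\<mu>, of order 1/y.\<close>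

lemma few_collisions_unlikely:
  assumes s: "power_sum 2 > 0" and k: "real k * sqrt (power_sum 2) \<ge> 3100" "k \<ge> 2"
    and \<tau>: "\<tau> \<le> 7/8 * (real k * (real k - 1) / 2 * power_sum 2)"
  shows "\<E> k (\<lambda>l. of_bool (real (collisions l) \<le> \<tau>)) \<le> 1/3"
proof -
  define c where "c = real k * (real k - 1) / 2"
  define \<sigma> where "\<sigma> = sqrt (power_sum 2)"
  define y where "y = real k * \<sigma>"
  have \<sigma>: "\<sigma> > 0" "power_sum 2 = \<sigma>\<^sup>2" using s by (simp_all add: \<sigma>_def)
  have y: "y \<ge> 3100" using k by (simp add: y_def \<sigma>_def)
  have c: "c \<ge> (real k)\<^sup>2 / 4"
  proof -
    have "real k * 2 \<le> real k * real k" using k by (intro mult_left_mono) auto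
    then show ?thesis by (simp add: c_def field_simps power2_eq_square)
  qed
  have cpos: "c > 0" using k by (simp add: c_def)
  define \<mu> where "\<mu> = c * \<sigma>\<^sup>2"
  have \<mu>: "\<mu> \<ge> y\<^sup>2 / 4" "\<mu> > 0"
    using mult_right_mono[OF c, of "\<sigma>\<^sup>2"] cpos \<sigma>
    by (simp_all add: \<mu>_def y_def power_mult_distrib)
  have "\<E> k (\<lambda>l. of_bool (real (collisions l) \<le> \<tau>))
      \<le> \<E> k (\<lambda>l. (real (collisions l) - \<mu>)\<^sup>2) / (\<mu> / 8)\<^sup>2"
  proof (rule chebyshev)
    show "\<bar>real (collisions l) - \<mu>\<bar> \<ge> \<mu> / 8" if "real (collisions l) \<le> \<tau>" for l
      using that \<tau> unfolding \<sigma>(2) c_def[symmetric] \<mu>_def[symmetric] by linarith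
  qed (use \<mu> in simp)
  also have "\<dots> \<le> (\<mu> + 2 * \<mu> * y) / (\<mu> / 8)\<^sup>2"
  proof (intro divide_right_mono)
    have kc: "real k * (real k - 1) = 2 * c" by (simp add: c_def)
    \<comment> \<open>The negative variance term is discarded, and the \<open>power_sum 3\<close>
      term is bounded by \<open>power_sum_3_le\<close> together with k - 2 \<le> k.\<close>
    have "c * (2 * real k - 3) * (\<sigma>\<^sup>2)\<^sup>2 \<ge> 0" using cpos k by simp
    moreover have "2 * c * (real k - 2) * power_sum 3 \<le> 2 * c * real k * (\<sigma>\<^sup>2 * \<sigma>)"
    proof (rule mult_mono)
      show "power_sum 3 \<le> \<sigma>\<^sup>2 * \<sigma>"
        using power_sum_3_le s by (simp add: \<sigma>_def)
      show "power_sum 3 \<ge> 0"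
        unfolding power_sum_def by (intro sum_nonneg zero_le_power nonneg)
    qed (use cpos in simp_all)
    moreover have "2 * c * real k * (\<sigma>\<^sup>2 * \<sigma>) = 2 * \<mu> * y"
      unfolding \<mu>_def y_def by simp
    moreover have "\<E> k (\<lambda>l. (real (collisions l) - \<mu>)\<^sup>2)
        = \<mu> + 2 * c * (real k - 2) * power_sum 3 - c * (2 * real k - 3) * (\<sigma>\<^sup>2)\<^sup>2"
      using variance_collisions[of k] unfolding \<sigma>(2) kc by (simp add: \<mu>_def)
    ultimately show "\<E> k (\<lambda>l. (real (collisions l) - \<mu>)\<^sup>2) \<le> \<mu> + 2 * \<mu> * y"
      by linarith
  qed simp
  also have "(\<mu> + 2 * \<mu> * y) / (\<mu> / 8)\<^sup>2 = 64 * (1 + 2 * y) / \<mu>"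
    using \<mu> by (simp add: field_simps power2_eq_square)
  also have "\<dots> \<le> 1/3"
  proof -
    \<comment> \<open>Since y \<ge> 3100, \<mu> \<ge> y^2/4 \<ge> 775y, which exceeds 3 * 64 * (1 +
      2y) = 192 + 384y.\<close>
    have "3100 * y \<le> y\<^sup>2" using y by (simp add: power2_eq_square)
    then have "775 * y \<le> \<mu>" using \<mu>(1) by linarith
    then have "64 * (1 + 2 * y) \<le> 1/3 * \<mu>" using y by (simp add: algebra_simps)
    then show ?thesis using \<mu>(2) by (subst pos_divide_le_eq)
  qed
  finally show ?thesis .
qed

text \<open>For a uniform distribution the collision events of distinct pairs are pairwise
  independent: the cubic terms of the variance cancel and it is at most the mean \<mu>. A deviation
  of \<mu>/6 then has probability at most 36/\<mu>, which equals 1/3 at \<mu> = 108.\<close>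

lemma many_collisions_unlikely:
  assumes q: "\<And>s. s \<in> A \<Longrightarrow> q s = p" and k: "real k * (real k - 1) / 2 * p \<ge> 108"
    and \<tau>: "\<tau> \<ge> 7/6 * (real k * (real k - 1) / 2 * p)"
  shows "\<E> k (\<lambda>l. of_bool (real (collisions l) > \<tau>)) \<le> 1/3"
proof -
  have "power_sum (Suc j) = (\<Sum>s\<in>A. q s * p ^ j)" for j
    unfolding power_sum_def by (intro sum.cong) (simp_all add: q)
  then have ps: "power_sum (Suc j) = p ^ j" for j
    by (simp add: sum_distrib_right[symmetric] total)
  have ps2: "power_sum 2 = p" and ps3: "power_sum 3 = p\<^sup>2"
    using ps[of 1] ps[of 2] by (simp_all add: numeral_2_eq_2 numeral_3_eq_3)
  define \<mu> where "\<mu> = real k * (real k - 1) / 2 * p"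
  have \<mu>: "\<mu> \<ge> 108" using k by (simp add: \<mu>_def)
  have "\<E> k (\<lambda>l. of_bool (real (collisions l) > \<tau>))
      \<le> \<E> k (\<lambda>l. (real (collisions l) - \<mu>)\<^sup>2) / (\<mu> / 6)\<^sup>2"
  proof (rule chebyshev)
    show "\<bar>real (collisions l) - \<mu>\<bar> \<ge> \<mu> / 6" if "real (collisions l) > \<tau>" for l
      using that \<tau> unfolding \<mu>_def[symmetric] by linarith
  qed (use \<mu> in simp)
  also have "\<E> k (\<lambda>l. (real (collisions l) - \<mu>)\<^sup>2) = \<mu> - real k * (real k - 1) / 2 * p\<^sup>2"
    using variance_collisions[of k] unfolding ps2 ps3 \<mu>_def[symmetric]
    by (simp add: \<mu>_def field_simps)
  also have "\<dots> / (\<mu> / 6)\<^sup>2 \<le> \<mu> / (\<mu> / 6)\<^sup>2"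
    by (intro divide_right_mono) (cases k; simp)+
  also have "\<dots> = 36 / \<mu>"
    using \<mu> by (simp add: field_simps power2_eq_square)
  also have "\<dots> \<le> 1/3" using \<mu> by (simp add: field_simps)
  finally show ?thesis .
qed

end

section \<open>The single-qubit Pauli measurement\<close>

text \<open>The operator |w><w|. The vector w need not be normalised, so the weight of a POVM
  element is absorbed into it.\<close>

definition outer :: "nat \<Rightarrow> (nat \<Rightarrow> complex) \<Rightarrow> complex mat" where
  "outer d w = Matrix.mat d d (\<lambda>(a, b). w a * cnj (w b))"

lemma outer_carrier [simp]: "outer d w \<in> carrier_mat d d"
  and outer_dim [simp]: "dim_row (outer d w) = d" "dim_col (outer d w) = d"
  and outer_index [simp]: "a < d \<Longrightarrow> b < d \<Longrightarrow> outer d w $$ (a, b) = w a * cnj (w b)"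
  by (simp_all add: outer_def)

lemma mat_adjoint_index:
  "A \<in> carrier_mat d d \<Longrightarrow> i < d \<Longrightarrow> j < d \<Longrightarrow> mat_adjoint A $$ (i, j) = cnj (A $$ (j, i))"
  by (simp add: mat_adjoint_def mat_of_rows_index)

text \<open>The quadratic form at v is the squared modulus of the inner product of w and v, called z
  in the proof.\<close>

lemma psd_outer: "psd d (outer d w)"
  unfolding psd_def
proof (intro conjI ballI)
  show "mat_adjoint (outer d w) = outer d w"
    by (rule eq_matI) (simp_all add: mat_adjoint_index[of _ d], simp_all add: mat_adjoint_def)
  fix v :: "complex Matrix.vec" assume v: "v \<in> carrier_vec d"
  define z where "z = (\<Sum>b<d. cnj (w b) * v $ b)"
  have "(outer d w *\<^sub>v v) \<bullet>c v = (\<Sum>a<d. (\<Sum>b<d. w a * cnj (w b) * v $ b) * cnj (v $ a))"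
    using v by (simp add: scalar_prod_def atLeast0LessThan)
  also have "\<dots> = (\<Sum>a<d. (w a * cnj (v $ a)) * z)"
    by (intro sum.cong) (simp_all add: z_def sum_distrib_left sum_distrib_right mult_ac)
  also have "\<dots> = cnj z * z"
    unfolding sum_distrib_right[symmetric] by (simp add: z_def)
  also have "\<dots> = of_real ((cmod z)\<^sup>2)"
    by (simp only: complex_norm_square mult.commute)
  finally have eq: "(outer d w *\<^sub>v v) \<bullet>c v = of_real ((cmod z)\<^sup>2)" .
  show "(outer d w *\<^sub>v v) \<bullet>c v \<in> \<real>" "0 \<le> Re ((outer d w *\<^sub>v v) \<bullet>c v)"
    unfolding eq by simp_all
qed simp

lemma trace_outer_mult:
  assumes "\<rho> \<in> carrier_mat d d"
  shows "mat_trace (outer d w * \<rho>) = (\<Sum>a<d. \<Sum>b<d. w a * cnj (w b) * \<rho> $$ (b, a))"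
  using assms by (simp add: mat_trace_def scalar_prod_def atLeast0LessThan)

text \<open>The trace is the quadratic form of \<rho> at the vector w.\<close>

lemma trace_outer_mult_nonneg:
  assumes "psd d \<rho>"
  shows "Re (mat_trace (outer d w * \<rho>)) \<ge> 0"
proof -
  have \<rho>: "\<rho> \<in> carrier_mat d d" using assms by (simp add: psd_def)
  have "(\<rho> *\<^sub>v Matrix.vec d w) \<bullet>c Matrix.vec d w = (\<Sum>b<d. \<Sum>a<d. w a * cnj (w b) * \<rho> $$ (b, a))"
    using \<rho> by (simp add: scalar_prod_def atLeast0LessThan sum_distrib_left mult_ac)
  also have "\<dots> = mat_trace (outer d w * \<rho>)"
    unfolding trace_outer_mult[OF \<rho>] by (rule sum.swap)
  finally show ?thesis using assms by (metis psd_def vec_carrier)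
qed

text \<open>Rows 0, 1 are the eigenvectors of Z, rows 2, 3 those of X, rows 4, 5 those of Y. Each
  unit vector is scaled by \<open>sqrt (1/3)\<close> because the basis is chosen uniformly; the X
  and Y rows carry a further factor \<open>sqrt (1/2)\<close> from normalisation.\<close>

definition pauli_amplitude :: "nat \<Rightarrow> nat \<Rightarrow> complex" where
  "pauli_amplitude c a =
     [[of_real (sqrt (1/3)), 0], [0, of_real (sqrt (1/3))],
      [of_real (sqrt (1/6)), of_real (sqrt (1/6))], [of_real (sqrt (1/6)), - of_real (sqrt (1/6))],
      [of_real (sqrt (1/6)), \<i> * of_real (sqrt (1/6))],
      [of_real (sqrt (1/6)), - \<i> * of_real (sqrt (1/6))]] ! c ! a"

text \<open>Outcome \<open>6 * i + c\<close> belongs to the coordinate pair \<open>{2 * i, 2 * i + 1}\<close> and to the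
  eigenvector number \<open>c\<close> of the three Pauli matrices acting on that pair. For \<open>i\<close> beyond the
  dimension the POVM element is the zero matrix.\<close>

definition pauli_vector :: "nat \<Rightarrow> nat \<Rightarrow> complex" where
  "pauli_vector s a = (if a div 2 = s div 6 then pauli_amplitude (s mod 6) (a mod 2) else 0)"

definition pauli_povm :: "nat \<Rightarrow> nat \<Rightarrow> complex mat" where
  "pauli_povm n s = outer (2 ^ n) (pauli_vector s)"

lemma sum_lessThan_6:
  "(\<Sum>c<6. f (c::nat)) = f 0 + f 1 + f 2 + f 3 + f 4 + (f 5 :: 'a :: comm_monoid_add)"
  by (simp add: eval_nat_numeral add.assoc)

lemma sum_lessThan_mult_6:
  "(\<Sum>s<6 * D. f s) = (\<Sum>i<D. \<Sum>c<6. f (6 * i + c :: nat) :: 'a :: comm_monoid_add)"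
proof (induction D)
  case (Suc D)
  have "(\<Sum>s<6 * Suc D. f s) = (\<Sum>s<6 * D. f s) + (\<Sum>c<6. f (6 * D + c))"
    unfolding sum_lessThan_6 by (simp add: eval_nat_numeral add.assoc)
  then show ?case using Suc by simp
qed simp

lemma sum_pair:
  fixes g :: "nat \<Rightarrow> 'a :: comm_monoid_add"
  assumes "i < D" and "\<And>a. a div 2 \<noteq> i \<Longrightarrow> g a = 0"
  shows "(\<Sum>a<2 * D. g a) = g (2 * i) + g (2 * i + 1)"
proof -
  have "(\<Sum>a<2 * D. g a) = (\<Sum>a\<in>{2 * i, 2 * i + 1}. g a)"
  proof (rule sum.mono_neutral_right)
    show "\<forall>a\<in>{..<2 * D} - {2 * i, 2 * i + 1}. g a = 0"
    proof
      fix a assume "a \<in> {..<2 * D} - {2 * i, 2 * i + 1}"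
      then have "a \<noteq> 2 * i" "a \<noteq> 2 * i + 1" by auto
      then have "a div 2 \<noteq> i" by presburger
      then show "g a = 0" by (rule assms(2))
    qed
  qed (use assms(1) in auto)
  then show ?thesis by simp
qed

lemma sum_pairs:
  fixes g :: "nat \<Rightarrow> 'a :: comm_monoid_add"
  shows "(\<Sum>a<2 * D. g a) = (\<Sum>i<D. g (2 * i) + g (2 * i + 1))"
  by (induction D) (simp_all add: add.assoc)

lemma sqrt_complex_mult:
  "x \<ge> 0 \<Longrightarrow> complex_of_real (sqrt x) * complex_of_real (sqrt x) = of_real x"
  by (metis of_real_mult real_sqrt_mult_self abs_of_nonneg)

lemma pauli_povm_eq_0:
  assumes "n \<ge> 1" "s \<ge> 6 * 2 ^ (n - 1)"
  shows "pauli_povm n s = 0\<^sub>m (2 ^ n) (2 ^ n)"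
proof (rule eq_matI)
  \<comment> \<open>The last qubit splits the coordinates into \<open>2 ^ (n - 1)\<close> pairs. At
    n = 0 truncated subtraction would make this identity false.\<close>
  have n: "(2::nat) ^ n = 2 * 2 ^ (n - 1)" using assms by (cases n) auto
  have "s div 6 \<ge> 2 ^ (n - 1)" using assms by (simp add: less_eq_div_iff_mult_less_eq mult.commute)
  then have "pauli_vector s a = 0" if "a < 2 ^ n" for a
    using that n by (auto simp: pauli_vector_def)
  then show "i < dim_row (0\<^sub>m (2 ^ n) (2 ^ n)) \<Longrightarrow> j < dim_col (0\<^sub>m (2 ^ n) (2 ^ n)) \<Longrightarrow>
    pauli_povm n s $$ (i, j) = 0\<^sub>m (2 ^ n) (2 ^ n) $$ (i, j)" for i j
    by (simp add: pauli_povm_def)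
qed (simp_all add: pauli_povm_def)

lemma povm_support_pauli:
  assumes "n \<ge> 1"
  shows "povm_support (2 ^ n) (pauli_povm n) \<subseteq> {..<6 * 2 ^ (n - 1)}"
  using pauli_povm_eq_0[OF assms] by (force simp: povm_support_def not_less)

lemma is_povm_pauli:
  assumes "n \<ge> 1"
  shows "is_povm n (pauli_povm n)"
  unfolding is_povm_def
proof (intro conjI allI impI)
  let ?S = "povm_support (2 ^ n) (pauli_povm n)"
  show fin: "finite ?S" using povm_support_pauli[OF assms] finite_subset by blast
  show "psd (2 ^ n) (pauli_povm n s)" for s by (simp add: pauli_povm_def psd_outer)
  fix a b :: nat assume ab: "a < 2 ^ n" "b < 2 ^ n"
  define D :: nat where "D = 2 ^ (n - 1)"
  have n: "(2::nat) ^ n = 2 * D" using assms unfolding D_def by (cases n) auto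
  have "(\<Sum>s\<in>?S. pauli_povm n s $$ (a, b)) = (\<Sum>s<6 * D. pauli_povm n s $$ (a, b))"
    using povm_support_pauli[OF assms] ab
    by (intro sum.mono_neutral_left) (auto simp: povm_support_def D_def)
  also have "\<dots> = (\<Sum>s<6 * D. pauli_vector s a * cnj (pauli_vector s b))"
    using ab by (simp add: pauli_povm_def)
  also have "\<dots> = (\<Sum>i<D. \<Sum>c<6. pauli_vector (6 * i + c) a * cnj (pauli_vector (6 * i + c) b))"
    by (rule sum_lessThan_mult_6)
  \<comment> \<open>If a and b both lie in pair i, each of the three bases contributes a third of
    the identity on that pair. Otherwise every term vanishes.\<close>
  also have "\<dots> = (\<Sum>i<D. if i = a div 2 then of_bool (a = b) else 0)"
  proof (intro sum.cong refl)
    fix i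
    show "(\<Sum>c<6. pauli_vector (6 * i + c) a * cnj (pauli_vector (6 * i + c) b))
       = (if i = a div 2 then of_bool (a = b) else 0)"
    proof (cases "i = a div 2 \<and> a div 2 = b div 2")
      case True
      have "a = b \<longleftrightarrow> a mod 2 = b mod 2" using True by (metis div_mult_mod_eq)
      moreover have "a mod 2 = 0 \<or> a mod 2 = 1" "b mod 2 = 0 \<or> b mod 2 = 1" by auto
      ultimately show ?thesis
        using True
        by (elim disjE)
          (simp_all add: sum_lessThan_6 pauli_vector_def pauli_amplitude_def sqrt_complex_mult
            mult.assoc mult.left_commute[of "complex_of_real _" \<i>])
    next
      case False
      then show ?thesis by (auto simp: pauli_vector_def intro!: sum.neutral)
    qed
  qed
  also have "\<dots> = 1\<^sub>m (2 ^ n) $$ (a, b)"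
    using ab n by auto
  finally show "(\<Sum>s\<in>?S. pauli_povm n s $$ (a, b)) = 1\<^sub>m (2 ^ n) $$ (a, b)" .
qed

section \<open>Outcome probabilities and collision probability of the measurement\<close>

definition pauli_prob :: "nat \<Rightarrow> complex mat \<Rightarrow> nat \<Rightarrow> real" where
  "pauli_prob n \<rho> s = Re (mat_trace (pauli_povm n s * \<rho>))"

text \<open>The vectors for i are supported on the coordinates 2i and 2i + 1, so only the 2x2
  diagonal block of \<rho> there matters. Z reads off its diagonal, X the real part and Y the
  imaginary part of the off-diagonal entry.\<close>

lemma pauli_prob_block:
  assumes \<rho>: "\<rho> \<in> carrier_mat (2 ^ n) (2 ^ n)" "mat_adjoint \<rho> = \<rho>" and n: "n \<ge> 1"
    and i: "i < 2 ^ (n - 1)"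
  defines "x \<equiv> Re (\<rho> $$ (2 * i, 2 * i))" and "y \<equiv> Re (\<rho> $$ (2 * i + 1, 2 * i + 1))"
    and "z \<equiv> \<rho> $$ (2 * i, 2 * i + 1)"
  shows "pauli_prob n \<rho> (6 * i) = x / 3"
    and "pauli_prob n \<rho> (6 * i + 1) = y / 3"
    and "pauli_prob n \<rho> (6 * i + 2) = (x + y + 2 * Re z) / 6"
    and "pauli_prob n \<rho> (6 * i + 3) = (x + y - 2 * Re z) / 6"
    and "pauli_prob n \<rho> (6 * i + 4) = (x + y - 2 * Im z) / 6"
    and "pauli_prob n \<rho> (6 * i + 5) = (x + y + 2 * Im z) / 6"
proof -
  have d: "(2::nat) ^ n = 2 * 2 ^ (n - 1)" using n by (cases n) auto
  have lt: "2 * i < 2 ^ n" "2 * i + 1 < 2 ^ n" using i unfolding d by auto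
  have herm: "\<rho> $$ (2 * i + 1, 2 * i) = cnj z"
    using mat_adjoint_index[OF \<rho>(1) lt(2,1)] \<rho>(2) by (simp add: z_def)
  \<comment> \<open>Both indices of the trace sum collapse to the pair, leaving the quadratic form
    of the block; hermiticity supplies its lower left entry.\<close>
  have key: "pauli_prob n \<rho> (6 * i + c) =
      Re (pauli_amplitude c 0 * cnj (pauli_amplitude c 0) * \<rho> $$ (2 * i, 2 * i)
        + pauli_amplitude c 0 * cnj (pauli_amplitude c 1) * cnj z
        + pauli_amplitude c 1 * cnj (pauli_amplitude c 0) * z
        + pauli_amplitude c 1 * cnj (pauli_amplitude c 1) * \<rho> $$ (2 * i + 1, 2 * i + 1))"
    if c: "c < 6" for c
  proof -
    let ?w = "pauli_vector (6 * i + c)"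
    have w: "?w a = (if a div 2 = i then pauli_amplitude c (a mod 2) else 0)" for a
      using c by (simp add: pauli_vector_def)
    have "pauli_prob n \<rho> (6 * i + c)
        = Re (\<Sum>a<2 ^ n. \<Sum>b<2 ^ n. ?w a * cnj (?w b) * \<rho> $$ (b, a))"
      using \<rho> by (simp add: pauli_prob_def pauli_povm_def trace_outer_mult)
    also have "(\<Sum>a<2 ^ n. \<Sum>b<2 ^ n. ?w a * cnj (?w b) * \<rho> $$ (b, a))
        = (\<Sum>a<2 ^ n. ?w a * cnj (?w (2 * i)) * \<rho> $$ (2 * i, a)
            + ?w a * cnj (?w (2 * i + 1)) * \<rho> $$ (2 * i + 1, a))"
      unfolding d by (intro sum.cong refl sum_pair i) (simp add: w)
    also have "\<dots> = (?w (2 * i) * cnj (?w (2 * i)) * \<rho> $$ (2 * i, 2 * i)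
            + ?w (2 * i) * cnj (?w (2 * i + 1)) * \<rho> $$ (2 * i + 1, 2 * i))
        + (?w (2 * i + 1) * cnj (?w (2 * i)) * \<rho> $$ (2 * i, 2 * i + 1)
            + ?w (2 * i + 1) * cnj (?w (2 * i + 1)) * \<rho> $$ (2 * i + 1, 2 * i + 1))"
      unfolding d by (intro sum_pair i) (simp add: w)
    finally show ?thesis
      unfolding herm z_def[symmetric] by (simp only: w add.assoc) simp
  qed
  have amp: "pauli_amplitude 0 0 = of_real (sqrt (1/3))" "pauli_amplitude 0 1 = 0"
    "pauli_amplitude 1 0 = 0" "pauli_amplitude 1 1 = of_real (sqrt (1/3))"
    "pauli_amplitude 2 0 = of_real (sqrt (1/6))" "pauli_amplitude 2 1 = of_real (sqrt (1/6))"
    "pauli_amplitude 3 0 = of_real (sqrt (1/6))" "pauli_amplitude 3 1 = - of_real (sqrt (1/6))"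
    "pauli_amplitude 4 0 = of_real (sqrt (1/6))" "pauli_amplitude 4 1 = \<i> * of_real (sqrt (1/6))"
    "pauli_amplitude 5 0 = of_real (sqrt (1/6))" "pauli_amplitude 5 1 = - \<i> * of_real (sqrt (1/6))"
    by (simp_all add: pauli_amplitude_def)
  have sq: "sqrt (1/3) * sqrt (1/3) = 1/3" "sqrt (1/6) * sqrt (1/6) = 1/6"
    "sqrt (1/3) * (sqrt (1/3) * t) = t / 3" "sqrt (1/6) * (sqrt (1/6) * t) = t / 6" for t
    by (simp_all only: mult.assoc[symmetric]) simp_all
  show "pauli_prob n \<rho> (6 * i) = x / 3"
    using key[of 0] unfolding amp by (simp add: x_def y_def sq del: real_sqrt_divide real_sqrt_one)
  show "pauli_prob n \<rho> (6 * i + 1) = y / 3"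
    using key[of 1] unfolding amp by (simp add: x_def y_def sq)
  show "pauli_prob n \<rho> (6 * i + 2) = (x + y + 2 * Re z) / 6"
    using key[of 2] unfolding amp by (simp add: x_def y_def sq)
  show "pauli_prob n \<rho> (6 * i + 3) = (x + y - 2 * Re z) / 6"
    using key[of 3] unfolding amp by (simp add: x_def y_def sq)
  show "pauli_prob n \<rho> (6 * i + 4) = (x + y - 2 * Im z) / 6"
    using key[of 4] unfolding amp by (simp add: x_def y_def sq)
  show "pauli_prob n \<rho> (6 * i + 5) = (x + y + 2 * Im z) / 6"
    using key[of 5] unfolding amp by (simp add: x_def y_def sq)
qed

text \<open>A nonzero 2x2 principal minor on the rows and columns i, j would force rank at least
  2.\<close>

lemma rank_1_minor:
  fixes A :: "complex mat"
  assumes A: "A \<in> carrier_mat d d" and rank: "vec_space.rank d A = 1" and ij: "i < j" "j < d"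
  shows "A $$ (i, i) * A $$ (j, j) = A $$ (i, j) * A $$ (j, i)"
proof -
  let ?S = "{i, j}"
  let ?B = "submatrix A ?S ?S"
  have S: "{k. k < d \<and> k \<in> ?S} = ?S" using ij by auto
  have card: "card ?S = 2" using ij by simp
  \<comment> \<open>\<open>pick\<close> enumerates the index set in increasing order, so i < j
    decides which index comes first.\<close>
  have pick0: "pick ?S 0 = i" using ij by (auto intro!: Least_equality)
  have pick1: "pick ?S 1 = j" using ij pick0 by (auto intro!: Least_equality)
  have B: "?B \<in> carrier_mat 2 2"
    using A S card by (simp add: submatrix_def)
  have B_index: "?B $$ (k, l) = A $$ (pick ?S k, pick ?S l)" if "k < 2" "l < 2" for k l
    using A S card that by (simp add: submatrix_def)
  have "Determinant.det ?B = 0"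
  proof (rule ccontr)
    assume "Determinant.det ?B \<noteq> 0"
    from vec_space.rank_gt_minor[OF A this] show False
      unfolding S card using rank by simp
  qed
  moreover have "Determinant.det ?B = ?B $$ (0, 0) * ?B $$ (1, 1) - ?B $$ (0, 1) * ?B $$ (1, 0)"
  proof -
    have single: "Determinant.det (mat_delete ?B 0 l) = mat_delete ?B 0 l $$ (0, 0)" for l
      using mat_delete_carrier[OF B] by (intro det_single) simp
    show ?thesis
      using laplace_expansion_row[OF B, of 0] B
      by (simp add: numeral_2_eq_2 cofactor_def single) (simp add: mat_delete_def)
  qed
  ultimately show ?thesis
    by (simp add: B_index pick0 pick1 del: pick.simps One_nat_def)
qed

text \<open>Each block is a multiple of the identity: x = y and z = 0, so all six block formulas
  give the same value.\<close>

lemma pauli_prob_max_mixed: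
  assumes n: "n \<ge> 1" and s: "s < 6 * 2 ^ (n - 1)"
  shows "pauli_prob n (max_mixed n) s = 1 / (3 * 2 ^ n)"
proof -
  define i where "i = s div 6"
  define c where "c = s mod 6"
  have d: "(2::nat) ^ n = 2 * 2 ^ (n - 1)" using n by (cases n) auto
  have i: "i < 2 ^ (n - 1)" using s by (simp add: i_def less_mult_imp_div_less mult.commute)
  have lt: "2 * i < 2 ^ n" "2 * i + 1 < 2 ^ n" using i unfolding d by auto
  have carrier: "max_mixed n \<in> carrier_mat (2 ^ n) (2 ^ n)" by (simp add: max_mixed_def)
  have adjoint: "mat_adjoint (max_mixed n) = max_mixed n"
  proof (rule eq_matI)
    show "mat_adjoint (max_mixed n) $$ (i, j) = max_mixed n $$ (i, j)"
      if "i < dim_row (max_mixed n)" "j < dim_col (max_mixed n)" for i j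
      using that carrier by (simp add: mat_adjoint_index[OF carrier]) (simp add: max_mixed_def)
  qed (simp_all add: max_mixed_def mat_adjoint_def)
  have "c < 6" by (simp add: c_def)
  then have c: "c = 0 \<or> c = 1 \<or> c = 2 \<or> c = 3 \<or> c = 4 \<or> c = 5" by auto
  have entries: "max_mixed n $$ (2 * i, 2 * i) = complex_of_real (1 / 2 ^ n)"
    "max_mixed n $$ (2 * i + 1, 2 * i + 1) = complex_of_real (1 / 2 ^ n)"
    "max_mixed n $$ (2 * i, 2 * i + 1) = 0"
    using lt by (simp_all add: max_mixed_def)
  have s_eq: "s = 6 * i + c" by (simp add: i_def c_def)
  show ?thesis
    using c unfolding s_eq
    by (elim disjE)
      (simp_all only: pauli_prob_block[OF carrier adjoint n i] entries add_0_right, simp_all)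
qed

lemma sum_pauli_prob_block:
  assumes "\<rho> \<in> carrier_mat (2 ^ n) (2 ^ n)" "mat_adjoint \<rho> = \<rho>" "n \<ge> 1" "i < 2 ^ (n - 1)"
  shows "(\<Sum>c<6. pauli_prob n \<rho> (6 * i + c))
    = Re (\<rho> $$ (2 * i, 2 * i)) + Re (\<rho> $$ (2 * i + 1, 2 * i + 1))"
  unfolding sum_lessThan_6 add_0_right pauli_prob_block[OF assms] by (simp add: field_simps)

lemma sum_pauli_prob:
  assumes \<rho>: "qstate n \<rho>" and n: "n \<ge> 1"
  shows "(\<Sum>s<6 * 2 ^ (n - 1). pauli_prob n \<rho> s) = 1"
proof -
  have carrier: "\<rho> \<in> carrier_mat (2 ^ n) (2 ^ n)" and adjoint: "mat_adjoint \<rho> = \<rho>"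
    and trace: "mat_trace \<rho> = 1"
    using \<rho> by (auto simp: qstate_def psd_def)
  have d: "(2::nat) ^ n = 2 * 2 ^ (n - 1)" using n by (cases n) auto
  have "(\<Sum>s<6 * 2 ^ (n - 1). pauli_prob n \<rho> s)
      = (\<Sum>i<2 ^ (n - 1). Re (\<rho> $$ (2 * i, 2 * i)) + Re (\<rho> $$ (2 * i + 1, 2 * i + 1)))"
    unfolding sum_lessThan_mult_6
    by (intro sum.cong refl sum_pauli_prob_block[OF carrier adjoint n]) simp
  also have "\<dots> = (\<Sum>a<2 ^ n. Re (\<rho> $$ (a, a)))"
    unfolding d sum_pairs ..
  also have "\<dots> = Re (mat_trace \<rho>)"
    using carrier by (simp add: mat_trace_def)
  finally show ?thesis by (simp add: trace)
qed

text \<open>Purity enters through the vanishing minor x * y = |z|^2 of each block, which reduces the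
  six squared probabilities to a multiple of the squared block weight. The block weights sum to 1
  over D blocks, so their squares sum to at least 1/D.\<close>

lemma collision_prob_pure_state:
  assumes pure: "pure_state n \<rho>" and n: "n \<ge> 1"
  shows "(\<Sum>s<6 * 2 ^ (n - 1). (pauli_prob n \<rho> s)\<^sup>2) \<ge> 4 / (9 * 2 ^ n)"
proof -
  define D :: nat where "D = 2 ^ (n - 1)"
  have d: "(2::nat) ^ n = 2 * D" using n by (cases n) (auto simp: D_def)
  have Dpos: "real D > 0" by (simp add: D_def)
  have carrier: "\<rho> \<in> carrier_mat (2 ^ n) (2 ^ n)" and adjoint: "mat_adjoint \<rho> = \<rho>"
    and state: "qstate n \<rho>" and rank: "vec_space.rank (2 ^ n) \<rho> = 1"
    using pure by (auto simp: pure_state_def qstate_def psd_def)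
  define u where "u i = Re (\<rho> $$ (2 * i, 2 * i)) + Re (\<rho> $$ (2 * i + 1, 2 * i + 1))" for i
  have block: "(\<Sum>c<6. pauli_prob n \<rho> (6 * i + c)) = u i"
    "(\<Sum>c<6. (pauli_prob n \<rho> (6 * i + c))\<^sup>2) = 2 / 9 * (u i)\<^sup>2" if i: "i < D" for i
  proof -
    note b = pauli_prob_block[OF carrier adjoint n i[unfolded D_def]]
    have lt: "2 * i < 2 ^ n" "2 * i + 1 < 2 ^ n" using i unfolding d by auto
    define x where "x = Re (\<rho> $$ (2 * i, 2 * i))"
    define y where "y = Re (\<rho> $$ (2 * i + 1, 2 * i + 1))"
    define z where "z = \<rho> $$ (2 * i, 2 * i + 1)"
    have herm: "\<rho> $$ (b, a) = cnj (\<rho> $$ (a, b))" if "a < 2 ^ n" "b < 2 ^ n" for a b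
      using mat_adjoint_index[OF carrier that(2,1)] adjoint by simp
    have real: "\<rho> $$ (a, a) = of_real (Re (\<rho> $$ (a, a)))" if "a < 2 ^ n" for a
      using herm[OF that that] by (simp add: complex_eq_iff)
    have "complex_of_real (x * y) = z * cnj z"
      using rank_1_minor[OF carrier rank _ lt(2), of "2 * i"]
        real[OF lt(1)] real[OF lt(2)] herm[OF lt] by (simp add: x_def y_def z_def)
    then have xy: "x * y = (Re z)\<^sup>2 + (Im z)\<^sup>2"
      by (simp add: complex_eq_iff power2_eq_square)
    show "(\<Sum>c<6. pauli_prob n \<rho> (6 * i + c)) = u i"
      unfolding u_def using i by (intro sum_pauli_prob_block[OF carrier adjoint n]) (simp add: D_def)
    \<comment> \<open>The terms linear in z cancel between the two eigenvectors of each basis; the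
      remaining |z|^2 is then replaced by x * y.\<close>
    have "9 * (\<Sum>c<6. (pauli_prob n \<rho> (6 * i + c))\<^sup>2)
        = x\<^sup>2 + y\<^sup>2 + (x + y)\<^sup>2 + 2 * ((Re z)\<^sup>2 + (Im z)\<^sup>2)"
      unfolding sum_lessThan_6 add_0_right b x_def[symmetric] y_def[symmetric] z_def[symmetric]
      by (simp add: field_simps power2_eq_square)
    also have "\<dots> = 2 * (x + y)\<^sup>2"
      unfolding xy[symmetric] by (simp add: algebra_simps power2_eq_square)
    finally show "(\<Sum>c<6. (pauli_prob n \<rho> (6 * i + c))\<^sup>2) = 2 / 9 * (u i)\<^sup>2"
      by (simp add: u_def x_def y_def)
  qed
  have total: "(\<Sum>i<D. u i) = 1"
    using sum_pauli_prob[OF state n] unfolding D_def[symmetric] sum_lessThan_mult_6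
    by (simp add: block)
  \<comment> \<open>Cauchy-Schwarz in tangent form: u^2 \<ge> 2u/D - 1/D^2 for each block, and the
    right-hand sides add up to 2/D - 1/D.\<close>
  have "1 / real D = (\<Sum>i<D. 2 * u i / real D - 1 / (real D)\<^sup>2)"
    unfolding sum_subtractf sum_divide_distrib[symmetric] sum_distrib_left[symmetric] total
    using Dpos by (simp add: field_simps power2_eq_square)
  also have "\<dots> \<le> (\<Sum>i<D. (u i)\<^sup>2)"
  proof (rule sum_mono)
    fix i
    have "(u i - 1 / real D)\<^sup>2 \<ge> 0" by simp
    then show "2 * u i / real D - 1 / (real D)\<^sup>2 \<le> (u i)\<^sup>2"
      by (simp add: power2_diff power_divide algebra_simps)
  qed
  finally have "2 / 9 * (1 / real D) \<le> 2 / 9 * (\<Sum>i<D. (u i)\<^sup>2)" by simp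
  also have "\<dots> = (\<Sum>s<6 * D. (pauli_prob n \<rho> s)\<^sup>2)"
    unfolding sum_lessThan_mult_6 by (simp add: block sum_distrib_left)
  also have "2 / 9 * (1 / real D) = 4 / (9 * real (2 ^ n))"
    unfolding d by simp
  finally show ?thesis by (simp add: D_def)
qed

section \<open>The collision test as an algorithm without quantum memory\<close>

lemma accept_from_fixed_povm:
  assumes \<rho>: "\<rho> \<in> carrier_mat (2 ^ n) (2 ^ n)"
    and A: "finite A" "povm_support (2 ^ n) F \<subseteq> A"
  shows "accept_from n \<rho> (\<lambda>_. F) f k h
    = iid_expectation A (\<lambda>s. Re (mat_trace (F s * \<rho>))) k (\<lambda>l. of_bool (f (h @ l)))"
proof (induction k arbitrary: h)
  case (Suc k)
  \<comment> \<open>Outcomes outside the support have probability zero, so the sum over the support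
    may be extended to \<open>A\<close>.\<close>
  have "Re (mat_trace (F s * \<rho>)) = 0" if "s \<notin> povm_support (2 ^ n) F" for s
  proof -
    have "F s = 0\<^sub>m (2 ^ n) (2 ^ n)" using that by (simp add: povm_support_def)
    then show ?thesis using \<rho> by (simp add: mat_trace_def)
  qed
  then show ?case
    using A by (simp add: Suc) (intro sum.mono_neutral_left, auto)
qed simp

lemma accept_prob_collision_test:
  assumes \<rho>: "\<rho> \<in> carrier_mat (2 ^ n) (2 ^ n)" and n: "n \<ge> 1"
  shows "accept_prob n (return_pmf 0) (\<lambda>_ _. pauli_povm n) (\<lambda>_ l. real (collisions l) > \<tau>) T \<rho>
    = iid_expectation {..<6 * 2 ^ (n - 1)} (pauli_prob n \<rho>) T
        (\<lambda>l. of_bool (real (collisions l) > \<tau>))"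
  unfolding accept_prob_def pauli_prob_def
  using accept_from_fixed_povm[OF \<rho> finite_lessThan povm_support_pauli[OF n]] by simp

theorem mainTheorem9:
  shows "\<exists>C :: real. \<forall>n :: nat. n \<ge> 1 \<longrightarrow>
    (\<exists>(T :: nat) (R :: nat pmf) (M :: nat \<Rightarrow> nat list \<Rightarrow> nat \<Rightarrow> complex mat)
       (f :: nat \<Rightarrow> nat list \<Rightarrow> bool).
       real T \<le> C * 2 powr (real n / 2) \<and>
       (\<forall>r h. is_povm n (M r h)) \<and>
       (\<forall>\<rho>. pure_state n \<rho> \<longrightarrow> accept_prob n R M f T \<rho> \<ge> 2/3) \<and>
       accept_prob n R M f T (max_mixed n) \<le> 1/3)"
\<comment> \<open>Rounding up gives T \<le> 5000\<sigma> + 1, and \<sigma> \<ge> 1 absorbs the extra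
  1.\<close>
proof (intro exI[of _ "5001 :: real"] allI impI)
  fix n :: nat assume n: "n \<ge> 1"
  define \<sigma> :: real where "\<sigma> = sqrt (2 ^ n)"
  \<comment> \<open>For a pure state \<open>sqrt (power_sum 2)\<close> is at least 2/(3\<sigma>), so
    the factor 5000 makes its product with T at least 10000/3, above the required 3100.\<close>
  define T where "T = nat \<lceil>5000 * \<sigma>\<rceil>"
  define P where "P = real T * (real T - 1) / 2"
  \<comment> \<open>\<open>P\<close> is the number of sample pairs. The mean collision count is 6/18
    * P / 2^n for the maximally mixed state and at least 8/18 * P / 2^n for a pure one. The
    threshold is the midpoint: 7/6 of the former and 7/8 of the latter bound.\<close>
  define \<tau> where "\<tau> = 7 / 18 * P / 2 ^ n"
  define A :: "nat set" where "A = {..<6 * 2 ^ (n - 1)}"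
  let ?M = "\<lambda>(_ :: nat) (_ :: nat list). pauli_povm n"
  let ?f = "\<lambda>(_ :: nat) (l :: nat list). real (collisions l) > \<tau>"
  have \<sigma>: "\<sigma> \<ge> 1" "\<sigma>\<^sup>2 = 2 ^ n" by (simp_all add: \<sigma>_def)
  have T: "real T \<ge> 5000 * \<sigma>" "real T \<le> 5000 * \<sigma> + 1"
    using \<sigma>(1) unfolding T_def by linarith+
  have T2: "T \<ge> 2" using T(1) \<sigma>(1) by linarith
  \<comment> \<open>324 = 3 * 108: with collision probability 1/(3 * 2^n) the mean then reaches the
    108 required by \<open>many_collisions_unlikely\<close>.\<close>
  have P: "P \<ge> 324 * 2 ^ n"
  proof -
    have "5000 * \<sigma> * \<sigma> \<le> real T * (real T - 1)"
      using T \<sigma>(1) by (intro mult_mono) auto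
    moreover have "5000 * \<sigma> * \<sigma> = 5000 * 2 ^ n"
      using \<sigma>(2) by (simp add: power2_eq_square)
    moreover have "(2::real) ^ n \<ge> 0" by simp
    ultimately show ?thesis unfolding P_def by linarith
  qed
  have "real T \<le> 5001 * 2 powr (real n / 2)"
  proof -
    have "2 powr (real n / 2) = \<sigma>"
      by (simp add: \<sigma>_def powr_half_sqrt[symmetric] powr_realpow[symmetric] powr_powr)
    then show ?thesis using T(2) \<sigma>(1) by simp
  qed
  moreover have "accept_prob n (return_pmf 0) ?M ?f T \<rho> \<ge> 2/3" if pure: "pure_state n \<rho>" for \<rho>
  proof -
    have state: "qstate n \<rho>" and psd: "psd (2 ^ n) \<rho>"
      and carrier: "\<rho> \<in> carrier_mat (2 ^ n) (2 ^ n)"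
      using pure by (auto simp: pure_state_def qstate_def psd_def)
    interpret finite_distribution A "pauli_prob n \<rho>"
    proof
      show "pauli_prob n \<rho> s \<ge> 0" for s
        unfolding pauli_prob_def pauli_povm_def by (rule trace_outer_mult_nonneg[OF psd])
    qed (use sum_pauli_prob[OF state n] in \<open>simp_all add: A_def\<close>)
    have ps: "power_sum 2 \<ge> 4 / (9 * 2 ^ n)"
      using collision_prob_pure_state[OF pure n] unfolding A_def[symmetric] power_sum_def .
    have "\<E> T (\<lambda>l. of_bool (real (collisions l) \<le> \<tau>)) \<le> 1/3"
    proof (rule few_collisions_unlikely[OF _ _ T2])
      have "4 / (9 * 2 ^ n :: real) > 0" by simp
      then show "power_sum 2 > 0" using ps by linarith
      have "2 / (3 * \<sigma>) \<le> sqrt (power_sum 2)"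
      proof (rule real_le_rsqrt)
        show "(2 / (3 * \<sigma>))\<^sup>2 \<le> power_sum 2"
          using ps \<sigma>(2) by (simp add: power_divide power_mult_distrib)
      qed
      then have "(5000 * \<sigma>) * (2 / (3 * \<sigma>)) \<le> real T * sqrt (power_sum 2)"
        using T(1) \<sigma>(1) by (intro mult_mono) auto
      moreover have "(5000 * \<sigma>) * (2 / (3 * \<sigma>)) = 10000 / 3" using \<sigma>(1) by simp
      ultimately show "3100 \<le> real T * sqrt (power_sum 2)" by linarith
      have "P \<ge> 0" using P by (rule order_trans[rotated]) simp
      from mult_left_mono[OF ps this]
      show "\<tau> \<le> 7/8 * (real T * (real T - 1) / 2 * power_sum 2)"
        unfolding P_def[symmetric] \<tau>_def by simp
    qed
    \<comment> \<open>Acceptance and rejection are complementary, so the bound 1/3 on rejection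
      yields 2/3 for acceptance.\<close>
    moreover have "\<E> T (\<lambda>l. of_bool (real (collisions l) > \<tau>))
        + \<E> T (\<lambda>l. of_bool (real (collisions l) \<le> \<tau>)) = 1"
      unfolding iid_expectation_add[symmetric]
      by (subst expectation_cong[where h="\<lambda>_. 1"]) auto
    ultimately show ?thesis
      using accept_prob_collision_test[OF carrier n, of \<tau> T] by (simp add: A_def)
  qed
  moreover have "accept_prob n (return_pmf 0) ?M ?f T (max_mixed n) \<le> 1/3"
  proof -
    have carrier: "max_mixed n \<in> carrier_mat (2 ^ n) (2 ^ n)" by (simp add: max_mixed_def)
    have q: "pauli_prob n (max_mixed n) s = 1 / (3 * 2 ^ n)" if "s \<in> A" for s
      using pauli_prob_max_mixed[OF n] that by (simp add: A_def)
    have d: "(2::real) ^ n = 2 * 2 ^ (n - 1)" using n by (cases n) auto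
    interpret finite_distribution A "pauli_prob n (max_mixed n)"
    proof
      show "sum (pauli_prob n (max_mixed n)) A = 1"
        by (simp add: q A_def[symmetric]) (simp add: A_def d)
    qed (simp_all add: A_def q[unfolded A_def])
    have "\<E> T (\<lambda>l. of_bool (real (collisions l) > \<tau>)) \<le> 1/3"
    proof (rule many_collisions_unlikely[OF q])
      show "108 \<le> real T * (real T - 1) / 2 * (1 / (3 * 2 ^ n))"
        using P unfolding P_def[symmetric] by (simp add: field_simps)
      show "7/6 * (real T * (real T - 1) / 2 * (1 / (3 * 2 ^ n))) \<le> \<tau>"
        unfolding P_def[symmetric] \<tau>_def by simp
    qed
    then show ?thesis
      using accept_prob_collision_test[OF carrier n, of \<tau> T] by (simp add: A_def)
  qed
  ultimately show "\<exists>T R M f. real T \<le> 5001 * 2 powr (real n / 2) \<and> (\<forall>r h. is_povm n (M r h)) \<and>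
      (\<forall>\<rho>. pure_state n \<rho> \<longrightarrow> accept_prob n R M f T \<rho> \<ge> 2/3) \<and>
      accept_prob n R M f T (max_mixed n) \<le> 1/3"
    using is_povm_pauli[OF n]
    by (intro exI[of _ T] exI[of _ "return_pmf 0"] exI[of _ ?M] exI[of _ ?f]) blast
qed

end
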